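(* Let $A$ be a real $n\times n$ matrix. The group inverses $L_A^{\#}$ and $S_A^{\#}$ of the Lyapunov operator $L_A$ and the Stein operator $S_A$ both exist if $A$ satisfies any one of the following conditions: (a) $A^2=-I$; (b) $A^2=I$; (c) $A^T=-A$; (d) $A^T=A$.
   Context: $\mathcal{S}^n$ denotes the real vector space of real symmetric $n\times n$ matrices. For a real $n\times n$ matrix $A$, the Lyapunov operator $L_A:\mathcal{S}^n\to\mathcal{S}^n$ is $L_A(X)=AX+XA^T$, and the Stein operator $S_A:\mathcal{S}^n\to\mathcal{S}^n$ is $S_A(X)=X-AXA^T$. A linear operator $T:V\to V$ on a finite dimensional vector space $V$ is said to have a group inverse if there is a linear operator $L:V\to V$ with $TLT=T$, $LTL=L$ and $TL=LT$; when it exists, it is unique and denoted $T^{\#}$. *)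

theory Defs
  imports "HOL-Analysis.Analysis"
begin

definition sym_matrices :: "(real^'n^'n) set" where
  "sym_matrices = {X. transpose X = X}"

definition lyapunov_op :: "real^'n^'n \<Rightarrow> real^'n^'n \<Rightarrow> real^'n^'n" where
  "lyapunov_op A X = A ** X + X ** transpose A"

definition stein_op :: "real^'n^'n \<Rightarrow> real^'n^'n \<Rightarrow> real^'n^'n" where
  "stein_op A X = X - A ** X ** transpose A"

text \<open>
  A linear operator on a subspace \<open>V\<close> is represented by a function on the ambient type
  of which only the restriction to \<open>V\<close> matters; its values outside \<open>V\<close> are unconstrained.
\<close>

definition linear_operator_on :: "'a::real_vector set \<Rightarrow> ('a \<Rightarrow> 'a) \<Rightarrow> bool" where
  "linear_operator_on V T \<longleftrightarrow>
     (\<forall>x\<in>V. T x \<in> V) \<and>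
     (\<forall>x\<in>V. \<forall>y\<in>V. T (x + y) = T x + T y) \<and>
     (\<forall>c. \<forall>x\<in>V. T (c *\<^sub>R x) = c *\<^sub>R T x)"

definition is_group_inverse_on ::
  "'a::real_vector set \<Rightarrow> ('a \<Rightarrow> 'a) \<Rightarrow> ('a \<Rightarrow> 'a) \<Rightarrow> bool" where
  "is_group_inverse_on V T L \<longleftrightarrow>
     linear_operator_on V L \<and>
     (\<forall>x\<in>V. T (L (T x)) = T x) \<and>
     (\<forall>x\<in>V. L (T (L x)) = L x) \<and>
     (\<forall>x\<in>V. T (L x) = L (T x))"

definition has_group_inverse_on :: "'a::real_vector set \<Rightarrow> ('a \<Rightarrow> 'a) \<Rightarrow> bool" where
  "has_group_inverse_on V T \<longleftrightarrow> (\<exists>L. is_group_inverse_on V T L)"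

lemma is_group_inverse_on_unique:
  assumes T: "linear_operator_on V T"
    and L: "is_group_inverse_on V T L" and M: "is_group_inverse_on V T M"
    and x: "x \<in> V"
  shows "L x = M x"
proof -
  have V: "T y \<in> V" "L y \<in> V" "M y \<in> V" if "y \<in> V" for y
    using that T L M by (auto simp: is_group_inverse_on_def linear_operator_on_def)
  have TLT: "T (L (T y)) = T y" and LTL: "L (T (L y)) = L y" and LT: "T (L y) = L (T y)"
    if "y \<in> V" for y using that L by (auto simp: is_group_inverse_on_def)
  have TMT: "T (M (T y)) = T y" and MTM: "M (T (M y)) = M y" and MT: "T (M y) = M (T y)"
    if "y \<in> V" for y using that M by (auto simp: is_group_inverse_on_def)
  have eq: "T (L y) = T (M y)" if y: "y \<in> V" for y
  proof -
    have "T (L y) = T (M (T (L y)))" using y by (simp add: TMT V)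
    also have "\<dots> = M (T (T (L y)))" using y by (simp add: MT V)
    also have "\<dots> = M (T (L (T y)))" using y by (simp add: LT V)
    also have "\<dots> = T (M y)" using y by (simp add: TLT MT)
    finally show ?thesis .
  qed
  have "L x = L (T (M x))" using LTL[OF x] eq[OF x] by simp
  also have "\<dots> = M (T (M x))"
    using LT[of "M x"] MT[of "M x"] eq[of "M x"] V x by simp
  also have "\<dots> = M x" using MTM x by simp
  finally show ?thesis .
qed

lemma subspace_sym_matrices: "subspace sym_matrices"
  by (auto simp: subspace_def sym_matrices_def transpose_def vec_eq_iff)

lemma transpose_add_matrix: "transpose (X + Y) = transpose X + transpose (Y :: real^'n^'m)"
  and transpose_diff_matrix: "transpose (X - Y) = transpose X - transpose (Y :: real^'n^'m)"
  by (auto simp: transpose_def vec_eq_iff)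

lemma matrix_mul_scaleR_left: "(c *\<^sub>R X) ** Y = c *\<^sub>R (X ** (Y :: real^'n^'m))"
  and matrix_mul_scaleR_right: "X ** (c *\<^sub>R Y) = c *\<^sub>R (X ** (Y :: real^'n^'m))"
  and matrix_mul_add_left: "(X + X') ** Y = X ** Y + X' ** (Y :: real^'n^'m)"
  by (auto simp: matrix_matrix_mult_def vec_eq_iff sum_distrib_left sum.distrib algebra_simps)

lemma linear_operator_on_lyapunov_op: "linear_operator_on sym_matrices (lyapunov_op A)"
  by (auto simp: linear_operator_on_def sym_matrices_def lyapunov_op_def transpose_add_matrix
      matrix_transpose_mul matrix_add_ldistrib matrix_mul_add_left
      matrix_mul_scaleR_left matrix_mul_scaleR_right scaleR_add_right)

lemma linear_operator_on_stein_op: "linear_operator_on sym_matrices (stein_op A)"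
  by (auto simp: linear_operator_on_def sym_matrices_def stein_op_def transpose_diff_matrix
      matrix_transpose_mul matrix_add_ldistrib matrix_mul_add_left matrix_mul_assoc
      matrix_mul_scaleR_left matrix_mul_scaleR_right scaleR_diff_right)

end

theory Submission
  imports Defs
begin

text \<open>
  A linear operator \<open>T\<close> on a finite dimensional space has a group inverse as soon as
  \<open>ker T\<^sup>2 = ker T\<close>, since \<open>T\<close> is then bijective on its range. If \<open>A\<^sup>2 = \<epsilon> I\<close> with
  \<open>\<epsilon>\<^sup>2 = 1\<close>, both operators satisfy \<open>T\<^sup>3 = c T\<close> with \<open>c \<noteq> 0\<close>. If \<open>A\<^sup>T = \<epsilon> A\<close>, both
  are self-adjoint or skew-adjoint for the Frobenius inner product. Either property gives
  \<open>ker T\<^sup>2 = ker T\<close>.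
\<close>

lemma has_group_inverse_on_if_kernel:
  fixes T :: "'a::euclidean_space \<Rightarrow> 'a"
  assumes V: "subspace V" and T: "linear T" and TV: "T ` V \<subseteq> V"
    and ker: "\<And>x. x \<in> V \<Longrightarrow> T (T x) = 0 \<Longrightarrow> T x = 0"
  shows "has_group_inverse_on V T"
proof -
  define W where "W = T ` V"
  have W: "subspace W" unfolding W_def using V T by (simp add: linear_subspace_image)
  have WV: "W \<subseteq> V" and TW: "T x \<in> W" if "x \<in> V" for x using TV that by (auto simp: W_def)
  have WV: "W \<subseteq> V" using TV by (simp add: W_def)
  \<comment> \<open>Differences of elements of \<open>W\<close> lie in the range, so the kernel
    condition applies to them.\<close>
  have inj: "inj_on T W"
  proof (rule inj_onI)
    fix x y assume "x \<in> W" "y \<in> W" and eq: "T x = T y"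
    then obtain z where z: "z \<in> V" "x - y = T z"
      using subspace_diff[OF W] unfolding W_def by blast
    have "T (T z) = 0" using eq by (simp add: z(2)[symmetric] linear_diff[OF T])
    with ker z show "x = y" by fastforce
  qed
  have surj: "T ` W = W"
  proof (rule subspace_dim_equal)
    show "subspace (T ` W)" using W T by (simp add: linear_subspace_image)
    show "T ` W \<subseteq> W" using WV by (auto simp: W_def)
    have "span W = W" using W by simp
    with dim_image_eq[OF T, of W] inj show "dim W \<le> dim (T ` W)" by simp
  qed (rule W)
  \<comment> \<open>A group inverse must map \<open>x\<close> to the \<open>y\<close> in
    \<open>W\<close> with \<open>T (T y) = T x\<close>; this condition serves as its
    definition.\<close>
  have "\<exists>y\<in>W. T (T y) = T x" if "x \<in> V" for x
    using surj TW[OF that] by (metis imageE)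
  then obtain L where LW: "\<And>x. x \<in> V \<Longrightarrow> L x \<in> W"
    and TTL: "\<And>x. x \<in> V \<Longrightarrow> T (T (L x)) = T x"
    by metis
  have eqI: "u = v" if "T u = T v" "u \<in> W" "v \<in> W" for u v
    using inj that by (auto dest: inj_onD)
  \<comment> \<open>Injectivity on \<open>W\<close>, used twice, makes \<open>y\<close> unique.
    Linearity and the group inverse identities then reduce to checking candidates.\<close>
  have LI: "L x = y" if "x \<in> V" "y \<in> W" "T (T y) = T x" for x y
  proof -
    have "L x \<in> V" "y \<in> V" using LW WV that by auto
    then have "T (L x) = T y" using that by - (rule eqI, simp_all add: TTL TW)
    then show ?thesis using that by - (rule eqI, simp_all add: LW)
  qed
  have L1: "L (x + y) = L x + L y" if "x \<in> V" "y \<in> V" for x y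
    using that by - (rule LI, auto simp: LW TTL linear_add[OF T] subspace_add V W)
  have L2: "L (c *\<^sub>R x) = c *\<^sub>R L x" if "x \<in> V" for x c
    using that by - (rule LI, auto simp: LW TTL linear_scale[OF T] subspace_scale V W)
  have LV: "L x \<in> V" if "x \<in> V" for x using LW WV that by blast
  have TVx: "T x \<in> V" if "x \<in> V" for x using TV that by blast
  have comm: "T (L x) = L (T x)" if "x \<in> V" for x
    by (rule LI[symmetric]) (simp_all add: TVx TW LV TTL that)
  have "T (L (T x)) = T x" if "x \<in> V" for x
    using that by (simp add: comm[symmetric] TTL)
  moreover have "L (T (L x)) = L x" if "x \<in> V" for x
    by (rule LI) (simp_all add: TVx LV LW TTL that)
  ultimately have "is_group_inverse_on V T L"
    by (simp add: is_group_inverse_on_def linear_operator_on_def L1 L2 LV comm)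
  then show ?thesis by (auto simp: has_group_inverse_on_def)
qed

lemma has_group_inverse_on_if_cube:
  fixes T :: "'a::euclidean_space \<Rightarrow> 'a"
  assumes "subspace V" "linear T" "T ` V \<subseteq> V"
    and "c \<noteq> 0" and cube: "\<And>x. x \<in> V \<Longrightarrow> T (T (T x)) = c *\<^sub>R T x"
  shows "has_group_inverse_on V T"
proof (rule has_group_inverse_on_if_kernel)
  fix x assume "x \<in> V" "T (T x) = 0"
  with cube[of x] show "T x = 0" using \<open>c \<noteq> 0\<close> by (simp add: linear_0[OF \<open>linear T\<close>])
qed fact+

text \<open>Taking \<open>y = T x\<close> gives
  \<open>T x \<bullet> T x = c * (x \<bullet> T (T x))\<close>, which vanishes when
  \<open>T (T x) = 0\<close>.\<close>

lemma has_group_inverse_on_if_adjoint: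
  fixes T :: "'a::euclidean_space \<Rightarrow> 'a"
  assumes "subspace V" "linear T" "T ` V \<subseteq> V"
    and adj: "\<And>x y. x \<in> V \<Longrightarrow> y \<in> V \<Longrightarrow> T x \<bullet> y = c * (x \<bullet> T y)"
  shows "has_group_inverse_on V T"
proof (rule has_group_inverse_on_if_kernel)
  fix x assume "x \<in> V" "T (T x) = 0"
  with adj[of x "T x"] \<open>T ` V \<subseteq> V\<close> show "T x = 0" by auto
qed fact+

lemma inner_transpose: "transpose X \<bullet> transpose Y = X \<bullet> (Y :: real^'n^'m)"
  by (simp add: inner_vec_def transpose_def) (rule sum.swap)

text \<open>Both sides are the same triple sum; three swaps turn the order \<open>i, j, k\<close>
  into \<open>k, j, i\<close>.\<close>

lemma inner_matrix_mul_left: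
  fixes A :: "real^'m^'k" and X :: "real^'n^'m" and Y :: "real^'n^'k"
  shows "(A ** X) \<bullet> Y = X \<bullet> (transpose A ** Y)"
proof -
  have "(A ** X) \<bullet> Y = (\<Sum>i\<in>UNIV. \<Sum>j\<in>UNIV. \<Sum>k\<in>UNIV. A$i$k * X$k$j * Y$i$j)"
    by (simp add: inner_vec_def matrix_matrix_mult_def sum_distrib_right)
  also have "\<dots> = (\<Sum>i\<in>UNIV. \<Sum>k\<in>UNIV. \<Sum>j\<in>UNIV. A$i$k * X$k$j * Y$i$j)"
    by (rule sum.cong[OF refl sum.swap])
  also have "\<dots> = (\<Sum>k\<in>UNIV. \<Sum>i\<in>UNIV. \<Sum>j\<in>UNIV. A$i$k * X$k$j * Y$i$j)"
    by (rule sum.swap)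
  also have "\<dots> = (\<Sum>k\<in>UNIV. \<Sum>j\<in>UNIV. \<Sum>i\<in>UNIV. A$i$k * X$k$j * Y$i$j)"
    by (rule sum.cong[OF refl sum.swap])
  also have "\<dots> = X \<bullet> (transpose A ** Y)"
    by (simp add: inner_vec_def matrix_matrix_mult_def transpose_def sum_distrib_left mult_ac)
  finally show ?thesis .
qed

text \<open>Transposition preserves the inner product and exchanges left and right factors.\<close>

lemma inner_matrix_mul_right:
  fixes X :: "real^'m^'k" and A :: "real^'n^'m" and Y :: "real^'n^'k"
  shows "(X ** A) \<bullet> Y = X \<bullet> (Y ** transpose A)"
  using inner_matrix_mul_left[of "transpose A" "transpose X" "transpose Y"]
    inner_transpose[of "X ** A" Y] inner_transpose[of X "Y ** transpose A"]
  by (simp add: matrix_transpose_mul)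

lemma linear_lyapunov_op: "linear (lyapunov_op A)"
  by (rule linearI) (simp_all add: lyapunov_op_def matrix_add_ldistrib matrix_mul_add_left
      matrix_mul_scaleR_left matrix_mul_scaleR_right scaleR_add_right)

lemma linear_stein_op: "linear (stein_op A)"
  by (rule linearI) (simp_all add: stein_op_def matrix_add_ldistrib matrix_mul_add_left
      matrix_mul_scaleR_left matrix_mul_scaleR_right scaleR_diff_right)

lemma lyapunov_op_image: "lyapunov_op A ` sym_matrices \<subseteq> sym_matrices"
  using linear_operator_on_lyapunov_op[of A] by (auto simp: linear_operator_on_def)

lemma stein_op_image: "stein_op A ` sym_matrices \<subseteq> sym_matrices"
  using linear_operator_on_stein_op[of A] by (auto simp: linear_operator_on_def)

lemma inner_lyapunov_op: "lyapunov_op A X \<bullet> Y = X \<bullet> lyapunov_op (transpose A) Y"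
  by (simp add: lyapunov_op_def inner_add_left inner_add_right inner_matrix_mul_left[of A]
      inner_matrix_mul_right[of X])

lemma inner_stein_op: "stein_op A X \<bullet> Y = X \<bullet> stein_op (transpose A) Y"
  by (simp add: stein_op_def inner_diff_left inner_diff_right inner_matrix_mul_left[of A]
      inner_matrix_mul_right[of "A ** X"] matrix_mul_assoc)

lemma lyapunov_op_scaleR: "lyapunov_op (c *\<^sub>R A) X = c *\<^sub>R lyapunov_op A X"
  by (simp add: lyapunov_op_def transpose_scalar matrix_mul_scaleR_left matrix_mul_scaleR_right
      scaleR_add_right)

text \<open>The matrix enters the product term twice, so a sign cancels.\<close>

lemma stein_op_scaleR: "c * c = 1 \<Longrightarrow> stein_op (c *\<^sub>R A) X = stein_op A X"
  by (simp add: stein_op_def transpose_scalar matrix_mul_scaleR_left matrix_mul_scaleR_right)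

context
  fixes A :: "real^'n^'n" and c :: real
  assumes square: "A ** A = c *\<^sub>R mat 1"
begin

text \<open>Left-nested, to match products normalised by \<open>matrix_mul_assoc\<close>.\<close>

lemma square_mul_right: "X ** transpose A ** transpose A = c *\<^sub>R X"
proof -
  have "transpose A ** transpose A = c *\<^sub>R mat 1"
    by (simp add: matrix_transpose_mul[symmetric] square transpose_scalar)
  then show ?thesis by (simp add: matrix_mul_assoc[symmetric] matrix_mul_scaleR_right)
qed

text \<open>Write \<open>T\<close> for the operator and \<open>P X = A ** X ** transpose A\<close>.
  Then \<open>T T = 2 (c I + P)\<close> and \<open>T P = c T\<close>, so
  \<open>T T T = 2 (c T + c T)\<close>.\<close>

lemma lyapunov_op_cube:
  "lyapunov_op A (lyapunov_op A (lyapunov_op A X)) = (4 * c) *\<^sub>R lyapunov_op A X"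
proof -
  have "lyapunov_op A (lyapunov_op A X) = 2 *\<^sub>R (c *\<^sub>R X + A ** X ** transpose A)"
    by (simp add: lyapunov_op_def matrix_add_ldistrib matrix_mul_add_left matrix_mul_assoc square
        square_mul_right matrix_mul_scaleR_left scaleR_2)
  moreover have "lyapunov_op A (A ** X ** transpose A) = c *\<^sub>R lyapunov_op A X"
    by (simp add: lyapunov_op_def square_mul_right matrix_mul_assoc square
        matrix_mul_scaleR_left scaleR_add_right)
  ultimately show ?thesis
    by (simp add: linear_add[OF linear_lyapunov_op] linear_scale[OF linear_lyapunov_op]
        scaleR_2[symmetric])
qed

text \<open>With the same \<open>P\<close>, the operator is \<open>S = I - P\<close> and
  \<open>P P = I\<close>. Hence \<open>S P = - S\<close>, so \<open>S S = 2 S\<close>.\<close>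

lemma stein_op_cube:
  assumes "c * c = 1"
  shows "stein_op A (stein_op A (stein_op A X)) = 4 *\<^sub>R stein_op A X"
proof -
  have "A ** (A ** Y ** transpose A) ** transpose A = (c * c) *\<^sub>R Y" for Y
    by (simp add: matrix_mul_assoc square square_mul_right matrix_mul_scaleR_left)
  then have "stein_op A (A ** Y ** transpose A) = - stein_op A Y" for Y
    using assms by (simp add: stein_op_def)
  then have "stein_op A (stein_op A Y) = 2 *\<^sub>R stein_op A Y" for Y
    by (simp add: stein_op_def[of A Y] linear_diff[OF linear_stein_op] scaleR_2)
  then show ?thesis
    by (simp add: linear_scale[OF linear_stein_op])
qed

end

theorem theorem3p15:
  fixes A :: "real^'n^'n"
  assumes "A ** A = - mat 1 \<or> A ** A = mat 1 \<or> transpose A = - A \<or> transpose A = A"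
  shows "has_group_inverse_on sym_matrices (lyapunov_op A) \<and>
         has_group_inverse_on sym_matrices (stein_op A)"
proof -
  \<comment> \<open>The four conditions pair up into two cases, each with a sign
    \<open>c\<close>.\<close>
  from assms consider
    (square) c :: real where "A ** A = c *\<^sub>R mat 1" "c * c = 1"
  | (transpose) c :: real where "transpose A = c *\<^sub>R A" "c * c = 1"
  proof (elim disjE)
    assume "A ** A = - mat 1" then show thesis using that(1)[of "-1"] by simp
  next
    assume "A ** A = mat 1" then show thesis using that(1)[of 1] by simp
  next
    assume "transpose A = - A" then show thesis using that(2)[of "-1"] by simp
  next
    assume "transpose A = A" then show thesis using that(2)[of 1] by simp
  qed
  then show ?thesis
  proof cases
    case square
    then have "4 * c \<noteq> 0" by auto
    then show ?thesis
      using has_group_inverse_on_if_cube[OF subspace_sym_matrices linear_lyapunov_op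
          lyapunov_op_image _ lyapunov_op_cube[OF square(1)]]
        has_group_inverse_on_if_cube[OF subspace_sym_matrices linear_stein_op
          stein_op_image _ stein_op_cube[OF square]]
      by simp
  next
    case transpose
    \<comment> \<open>The Lyapunov operator is linear in \<open>A\<close> and inherits the sign
      \<open>c\<close>; the Stein operator is self-adjoint for either sign.\<close>
    have "lyapunov_op A X \<bullet> Y = c * (X \<bullet> lyapunov_op A Y)"
      and "stein_op A X \<bullet> Y = 1 * (X \<bullet> stein_op A Y)" for X Y
      using transpose
      by (simp_all add: inner_lyapunov_op inner_stein_op lyapunov_op_scaleR stein_op_scaleR)
    then show ?thesis
      by (auto intro!: has_group_inverse_on_if_adjoint[OF subspace_sym_matrices
            linear_lyapunov_op lyapunov_op_image, of A c]
          has_group_inverse_on_if_adjoint[OF subspace_sym_matrices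
            linear_stein_op stein_op_image, of A 1])
  qed
qed

end
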